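(* Let $\alpha\in(0,\pi)$. Put $V_{0}^{\alpha}=\{1\}$ (the constant function on $\Omega^{\alpha}$), and for every integer $n\geq 1$ let $$V_{n}^{\alpha}=V_{n-1}^{\alpha}\cup\left\{\cos(ru+gv+bw),\ \sin(ru+gv+bw)\ :\ [ru+gv+bw]\in E_{n}^{\alpha}/_{\sim}\setminus\bigcup_{i=0}^{n-1}E_{i}^{\alpha}/_{\sim}\right\},$$ where from each equivalence class a single representative $ru+gv+bw$ is chosen. Then: (1) for every $n\ge 1$, $$E_{n}^{\alpha}/_{\sim}\setminus\bigcup_{i=0}^{n-1}E_{i}^{\alpha}/_{\sim}=\left\{[0\cdot u+g\cdot v+n\cdot w]\right\}_{g=0}^{n-1}\cup\left\{[n\cdot u+0\cdot v+b\cdot w]\right\}_{b=0}^{n-1}\cup\left\{[r\cdot u+n\cdot v+0\cdot w]\right\}_{r=0}^{n-1};$$ (2) for every $n\ge 0$, $V_{n}^{\alpha}$ is a basis of the vector space $\mathcal{V}_{n}^{\alpha}$; and for every $n\geq 1$, $V_n^{\alpha}$ is obtained by completing $V_{n-1}^{\alpha}$ with $6n$ new linearly independent constrained trivariate functions defined over $\Omega^{\alpha}$.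
   Context: For $\alpha\in(0,\pi)$ let $\Omega^{\alpha}=\{(u,v,w)\in[0,\alpha]^3: u+v+w=\alpha\}$. All functions are real-valued functions of $(u,v,w)\in\Omega^{\alpha}$, and spans are over $\mathbb{R}$. For an integer $n\ge 0$, $$\mathcal{V}_n^{\alpha}=\operatorname{span}\left\{\cos(ru+gv+bw),\ \sin(ru+gv+bw)\ :\ r,g,b\in\{0,1,\ldots,n\}\right\}.$$ Let $E_n^{\alpha}=\{ru+gv+bw: r,g,b\in\{0,1,\ldots,n\}\}$, regarded as a set of formal combinations, i.e. identified with the set of triples $(r,g,b)$. Two elements $r_1u+g_1v+b_1w$ and $r_2u+g_2v+b_2w$ of $E_n^{\alpha}$ are called equivalent, written $\sim$, if and only if there is an integer $z\in\{-n,\ldots,2n\}$ such that either $r_2+r_1=g_2+g_1=b_2+b_1=z$, or $r_2-r_1=g_2-g_1=b_2-b_1=z$. This is an equivalence relation; $[ru+gv+bw]$ denotes the class of $ru+gv+bw$ and $E_n^{\alpha}/_{\sim}$ the set of all classes. For $i<n$ we have $E_i^\alpha\subset E_n^\alpha$, and a class in $E_i^{\alpha}/_{\sim}$ is identified with the class in $E_n^{\alpha}/_{\sim}$ containing it; thus $E_{n}^{\alpha}/_{\sim}\setminus\bigcup_{i=0}^{n-1}E_{i}^{\alpha}/_{\sim}$ consists of the classes in $E_n^{\alpha}/_{\sim}$ that contain no element of $E_{n-1}^{\alpha}$. *)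

theory Defs
  imports "HOL-Analysis.Analysis" "HOL-Library.Function_Algebras"
begin

text \<open>Pointwise scalar multiplication makes functions into a real vector space, so that the
  library's \<^const>\<open>span\<close> and \<^const>\<open>independent\<close> apply to sets of functions.\<close>

instantiation "fun" :: (type, real_vector) real_vector
begin

definition scaleR_fun_def: "c *\<^sub>R f = (\<lambda>x. c *\<^sub>R f x)"

instance
  by standard (auto simp: scaleR_fun_def fun_eq_iff algebra_simps)

end

definition Omega :: "real \<Rightarrow> (real \<times> real \<times> real) set" where
  "Omega \<alpha> = {(u, v, w). u \<in> {0..\<alpha>} \<and> v \<in> {0..\<alpha>} \<and> w \<in> {0..\<alpha>} \<and> u + v + w = \<alpha>}"

text \<open>A function on \<^term>\<open>Omega \<alpha>\<close> is represented by its extension by zero to the whole type.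
  Extension by zero is a linear isomorphism from the space of all real functions on
  \<^term>\<open>Omega \<alpha>\<close> onto the space of functions vanishing outside it, so equality, spans and linear
  independence are those of functions on \<^term>\<open>Omega \<alpha>\<close>.\<close>

definition on_Omega ::
  "real \<Rightarrow> (real \<times> real \<times> real \<Rightarrow> real) \<Rightarrow> (real \<times> real \<times> real \<Rightarrow> real)" where
  "on_Omega \<alpha> f = (\<lambda>p. if p \<in> Omega \<alpha> then f p else 0)"

text \<open>The triple \<open>(r, g, b)\<close> stands for the formal combination \<open>r u + g v + b w\<close>.\<close>

type_synonym comb = "int \<times> int \<times> int"

fun comb_val :: "comb \<Rightarrow> real \<times> real \<times> real \<Rightarrow> real" where
  "comb_val (r, g, b) (u, v, w) = of_int r * u + of_int g * v + of_int b * w"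

definition cos_fn :: "real \<Rightarrow> comb \<Rightarrow> (real \<times> real \<times> real \<Rightarrow> real)" where
  "cos_fn \<alpha> e = on_Omega \<alpha> (\<lambda>p. cos (comb_val e p))"

definition sin_fn :: "real \<Rightarrow> comb \<Rightarrow> (real \<times> real \<times> real \<Rightarrow> real)" where
  "sin_fn \<alpha> e = on_Omega \<alpha> (\<lambda>p. sin (comb_val e p))"

definition combs :: "nat \<Rightarrow> comb set" where
  "combs n = {0..int n} \<times> {0..int n} \<times> {0..int n}"

definition trig_space :: "real \<Rightarrow> nat \<Rightarrow> (real \<times> real \<times> real \<Rightarrow> real) set" where
  "trig_space \<alpha> n = span (cos_fn \<alpha> ` combs n \<union> sin_fn \<alpha> ` combs n)"

definition comb_equiv :: "nat \<Rightarrow> (comb \<times> comb) set" where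
  "comb_equiv n = {((r1, g1, b1), (r2, g2, b2)).
     (r1, g1, b1) \<in> combs n \<and> (r2, g2, b2) \<in> combs n \<and>
     (\<exists>z \<in> {- int n..2 * int n}.
        (r2 + r1 = z \<and> g2 + g1 = z \<and> b2 + b1 = z) \<or>
        (r2 - r1 = z \<and> g2 - g1 = z \<and> b2 - b1 = z))}"

lemma comb_equiv_iff:
  "((r1, g1, b1), (r2, g2, b2)) \<in> comb_equiv n \<longleftrightarrow>
     (r1, g1, b1) \<in> combs n \<and> (r2, g2, b2) \<in> combs n \<and>
     (r2 + r1 = g2 + g1 \<and> g2 + g1 = b2 + b1 \<or> r2 - r1 = g2 - g1 \<and> g2 - g1 = b2 - b1)"
proof -
  have "r2 + r1 \<in> {- int n..2 * int n}" "r2 - r1 \<in> {- int n..2 * int n}"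
    if "(r1, g1, b1) \<in> combs n" "(r2, g2, b2) \<in> combs n"
    using that by (auto simp: combs_def)
  then show ?thesis
    unfolding comb_equiv_def by auto
qed

lemma equiv_comb_equiv: "equiv (combs n) (comb_equiv n)"
proof (rule equivI)
  show "comb_equiv n \<subseteq> combs n \<times> combs n"
    by (auto simp: comb_equiv_def)
  show "refl_on (combs n) (comb_equiv n)"
    by (auto simp: refl_on_def comb_equiv_def)
  show "sym (comb_equiv n)"
  proof (rule symI)
    fix x y assume "(x, y) \<in> comb_equiv n"
    then show "(y, x) \<in> comb_equiv n"
      by (cases x; cases y; simp add: comb_equiv_iff combs_def) linarith
  qed
  show "trans (comb_equiv n)"
  proof (rule transI)
    fix x y z assume "(x, y) \<in> comb_equiv n" "(y, z) \<in> comb_equiv n"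
    then show "(x, z) \<in> comb_equiv n"
      by (cases x; cases y; cases z; simp add: comb_equiv_iff combs_def) linarith
  qed
qed

abbreviation comb_class :: "nat \<Rightarrow> comb \<Rightarrow> comb set" where
  "comb_class n e \<equiv> comb_equiv n `` {e}"

text \<open>For \<open>i \<le> n\<close>, the class in \<open>combs n // comb_equiv n\<close> that contains a given class \<open>C\<close> of
  \<open>combs i // comb_equiv i\<close> is \<open>comb_equiv n `` C\<close>; subtracting these images implements the
  identification of classes at different levels.\<close>

definition new_classes :: "nat \<Rightarrow> comb set set" where
  "new_classes n =
     combs n // comb_equiv n - (\<Union>i<n. (\<lambda>C. comb_equiv n `` C) ` (combs i // comb_equiv i))"

lemma comb_equiv_mono:
  assumes "i \<le> n"
  shows "comb_equiv i \<subseteq> comb_equiv n"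
  using assms by (auto simp: comb_equiv_iff combs_def)

lemma combs_mono: "i \<le> n \<Longrightarrow> combs i \<subseteq> combs n"
  by (auto simp: combs_def)

lemma Image_class:
  assumes "i \<le> n" "e \<in> combs i"
  shows "comb_equiv n `` (comb_class i e) = comb_class n e"
proof -
  note eqv = equiv_comb_equiv[of n]
  have "(e, e) \<in> comb_equiv i"
    using equiv_comb_equiv[of i] assms(2) by (auto simp: equiv_def refl_on_def)
  then have "comb_class n e \<subseteq> comb_equiv n `` (comb_class i e)"
    by auto
  moreover have "comb_equiv n `` (comb_class i e) \<subseteq> comb_class n e"
    using comb_equiv_mono[OF assms(1)] eqv by (auto simp: equiv_def dest: transD)
  ultimately show ?thesis by auto
qed

lemma new_classes_eq:
  assumes "n \<ge> 1"
  shows "new_classes n = {C \<in> combs n // comb_equiv n. C \<inter> combs (n - 1) = {}}"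
proof -
  note eqv = equiv_comb_equiv[of n]
  have "C \<in> (\<Union>i<n. (\<lambda>C. comb_equiv n `` C) ` (combs i // comb_equiv i)) \<longleftrightarrow>
        C \<inter> combs (n - 1) \<noteq> {}" if C: "C \<in> combs n // comb_equiv n" for C
  proof
    assume "C \<in> (\<Union>i<n. (\<lambda>C. comb_equiv n `` C) ` (combs i // comb_equiv i))"
    then obtain i e where i: "i < n" "e \<in> combs i" "C = comb_equiv n `` (comb_class i e)"
      by (auto elim!: quotientE)
    then have "C = comb_class n e" using Image_class by simp
    moreover have "i \<le> n - 1" using i(1) by simp
    then have "e \<in> combs (n - 1)" using i(2) combs_mono by blast
    ultimately show "C \<inter> combs (n - 1) \<noteq> {}"
      using combs_mono[of "n - 1" n] eqv by (auto simp: equiv_def refl_on_def)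
  next
    assume "C \<inter> combs (n - 1) \<noteq> {}"
    then obtain e where e: "e \<in> C" "e \<in> combs (n - 1)" by auto
    have "C = comb_class n e"
      using C e(1) eqv by (metis Image_singleton_iff equiv_class_eq quotientE)
    also have "\<dots> = comb_equiv n `` (comb_class (n - 1) e)"
      using Image_class[of "n - 1" n e] e(2) by simp
    finally show "C \<in> (\<Union>i<n. (\<lambda>C. comb_equiv n `` C) ` (combs i // comb_equiv i))"
      using assms e(2) by (auto intro!: bexI[of _ "n - 1"] imageI quotientI)
  qed
  then show ?thesis unfolding new_classes_def by blast
qed

text \<open>\<open>rep n C\<close> is the representative chosen from the class \<open>C\<close> that is new at level \<open>n\<close>.\<close>

definition choice_of_reps :: "(nat \<Rightarrow> comb set \<Rightarrow> comb) \<Rightarrow> bool" where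
  "choice_of_reps rep \<longleftrightarrow> (\<forall>n \<ge> 1. \<forall>C \<in> new_classes n. rep n C \<in> C)"

definition new_fns ::
  "real \<Rightarrow> (nat \<Rightarrow> comb set \<Rightarrow> comb) \<Rightarrow> nat \<Rightarrow> (real \<times> real \<times> real \<Rightarrow> real) set" where
  "new_fns \<alpha> rep n = (\<Union>C \<in> new_classes n. {cos_fn \<alpha> (rep n C), sin_fn \<alpha> (rep n C)})"

primrec trig_basis ::
  "real \<Rightarrow> (nat \<Rightarrow> comb set \<Rightarrow> comb) \<Rightarrow> nat \<Rightarrow> (real \<times> real \<times> real \<Rightarrow> real) set" where
  "trig_basis \<alpha> rep 0 = {on_Omega \<alpha> (\<lambda>_. 1)}"
| "trig_basis \<alpha> rep (Suc n) = trig_basis \<alpha> rep n \<union> new_fns \<alpha> rep (Suc n)"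

end

theory Submission
  imports Defs
begin

text \<open>
  On \<^term>\<open>Omega \<alpha>\<close> one has \<open>u + v + w = \<alpha>\<close>, so adding a common integer \<open>z\<close> to the coefficients of
  \<open>r u + g v + b w\<close> only shifts the argument of cosine and sine by the constant \<open>z \<alpha>\<close>, and negating
  all coefficients negates the argument. The cosine and sine of equivalent
  combinations therefore span the same space of functions (\<open>trig_fn_sim_in_span\<close>), and a class other than that of
  \<open>(0, 0, 0)\<close> is the same thing as a nonzero frequency \<open>(r - b, g - b)\<close> of the plane coordinates
  \<open>(u, v)\<close>, up to sign.

  The counting rests on one invariant of a class, the spread \<open>max r g b - min r g b\<close>: it is the least
  \<open>n\<close> such that the class meets \<^term>\<open>combs n\<close>. Hence the classes new at level \<open>n\<close> are those of spread
  \<open>n\<close>. Their frequencies are the \<open>6 n\<close> points of the hexagon \<open>max \<bar>p\<bar> \<bar>q\<bar> \<bar>p - q\<bar> = n\<close> of the lattice;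
  the central symmetry pairs them, and the three listed families are half of that hexagon. This
  gives \<open>3 n\<close> new classes and \<open>6 n\<close> new functions. It also gives the span: every class that meets
  \<^term>\<open>combs n\<close> is either constant or new at exactly one level between \<open>1\<close> and \<open>n\<close>.

  Linear independence is reduced to one variable. Along the segment
  \<open>(t, N t, \<alpha> - (N + 1) t)\<close> with small \<open>t > 0\<close>, a combination of frequency \<open>(p, q)\<close> oscillates with the
  integer frequency \<open>p + q N\<close>, and for \<open>N = 2 n + 1\<close> these integers have distinct absolute
  values for distinct classes at level at most \<open>n\<close> (\<open>sim_if_abs_line_freq_eq\<close>). A real trigonometric
  polynomial with such frequencies becomes, up to a power of \<open>cis t\<close>, a complex polynomial in
  \<open>cis t\<close>. If it vanishes on an interval then this polynomial has infinitely many roots, so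
  all its coefficients vanish (\<open>trig_poly_coeffs_zero\<close>).
\<close>

section \<open>Real trigonometric polynomials in one variable\<close>

text \<open>
  Each summand is the real part of \<open>C\<^sub>j * cis (k\<^sub>j * t)\<close> with \<open>C\<^sub>j = (a\<^sub>j - \<i> b\<^sub>j) * cis \<phi>\<^sub>j\<close>.
  Writing the real part as half the sum with the conjugate and multiplying by a high power of
  \<open>cis t\<close> gives a polynomial in \<open>cis t\<close>. Since the \<open>\<bar>k\<^sub>j\<bar>\<close> are distinct, the coefficients \<open>C\<^sub>j\<close> and
  \<open>cnj C\<^sub>j\<close> do not interact with those of other indices; they meet only each other, at frequency
  \<open>0\<close>, where only the constant value of the summand can be recovered.
\<close>

lemma trig_poly_coeffs_zero:
  fixes a b \<phi> :: "'i \<Rightarrow> real" and k :: "'i \<Rightarrow> int" and \<epsilon> :: real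
  assumes fin: "finite J" and eps: "\<epsilon> > 0"
    and inj: "inj_on (\<lambda>j. \<bar>k j\<bar>) J"
    and zero: "\<And>t :: real. 0 < t \<Longrightarrow> t < \<epsilon> \<Longrightarrow>
      (\<Sum>j\<in>J. a j * cos (k j * t + \<phi> j) + b j * sin (k j * t + \<phi> j)) = 0"
    and i: "i \<in> J"
  shows "k i \<noteq> 0 \<Longrightarrow> a i = 0 \<and> b i = 0"
    and "k i = 0 \<Longrightarrow> a i * cos (\<phi> i) + b i * sin (\<phi> i) = 0"
proof -
  define C where "C j = Complex (a j) (- b j) * cis (\<phi> j)" for j
  define K where "K = (\<Sum>j\<in>J. \<bar>k j\<bar>)"
  \<comment> \<open>The shift by \<open>K\<close> makes all exponents nonnegative.\<close>
  have K: "\<bar>k j\<bar> \<le> K" if "j \<in> J" for j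
    unfolding K_def using fin that by (intro member_le_sum) auto
  define P where "P = (\<Sum>j\<in>J. monom (C j) (nat (K + k j)) + monom (cnj (C j)) (nat (K - k j)))"
  have root: "poly P (cis t) = 0" if t: "0 < t" "t < \<epsilon>" for t
  proof -
    have term_eq: "C j * cis t ^ nat (K + k j) + cnj (C j) * cis t ^ nat (K - k j) =
        cis (K * t) * of_real (2 * (a j * cos (k j * t + \<phi> j) + b j * sin (k j * t + \<phi> j)))"
      if "j \<in> J" for j
    proof -
      have "cis t ^ nat (K + k j) = cis (K * t) * cis (k j * t)"
        using K[OF that] by (simp add: Complex.DeMoivre cis_mult algebra_simps)
      moreover have "cis t ^ nat (K - k j) = cis (K * t) * cnj (cis (k j * t))"
        using K[OF that] by (simp add: Complex.DeMoivre cis_mult cis_cnj algebra_simps)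
      moreover define w where "w = C j * cis (k j * t)"
      ultimately have "C j * cis t ^ nat (K + k j) + cnj (C j) * cis t ^ nat (K - k j) =
          cis (K * t) * (w + cnj w)"
        by (simp add: algebra_simps)
      moreover have "w = Complex (a j) (- b j) * cis (k j * t + \<phi> j)"
        unfolding w_def C_def by (simp add: cis_mult algebra_simps)
      then have "Re w = a j * cos (k j * t + \<phi> j) + b j * sin (k j * t + \<phi> j)"
        by simp
      ultimately show ?thesis by (simp add: complex_add_cnj)
    qed
    have "poly P (cis t) = (\<Sum>j\<in>J. cis (K * t) *
        of_real (2 * (a j * cos (k j * t + \<phi> j) + b j * sin (k j * t + \<phi> j))))"
      unfolding P_def poly_sum by (intro sum.cong) (simp_all only: term_eq poly_add poly_monom)
    also have "\<dots> = cis (K * t) * of_real (2 *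
        (\<Sum>j\<in>J. a j * cos (k j * t + \<phi> j) + b j * sin (k j * t + \<phi> j)))"
      by (simp only: sum_distrib_left of_real_sum)
    also have "\<dots> = 0" using zero[OF t] by simp
    finally show ?thesis .
  qed
  have "P = 0"
  proof (rule ccontr)
    assume "P \<noteq> 0"
    \<comment> \<open>The bound \<open>1 < pi\<close> keeps \<open>cis\<close> injective, since \<open>cos\<close> is injective on \<open>[0, pi]\<close>.\<close>
    define T where "T = {0<..<min \<epsilon> 1}"
    have "inj_on cis T"
    proof (rule inj_onI)
      fix x y assume xy: "x \<in> T" "y \<in> T" "cis x = cis y"
      have "1 < pi" using pi_gt3 by linarith
      then show "x = y"
        using xy cos_inj_pi[of x y] by (auto simp: T_def complex_eq_iff)
    qed
    moreover have "infinite T" using eps by (simp add: T_def infinite_Ioo)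
    ultimately have "infinite (cis ` T)" using finite_imageD by blast
    moreover have "cis ` T \<subseteq> {z. poly P z = 0}" using root by (auto simp: T_def)
    ultimately show False using poly_roots_finite[OF \<open>P \<noteq> 0\<close>] finite_subset by blast
  qed
  have "coeff P (nat (K + k i)) =
      (\<Sum>j\<in>J. if j = i then C i + (if k i = 0 then cnj (C i) else 0) else 0)"
    unfolding P_def coeff_sum
  proof (intro sum.cong refl)
    fix j assume j: "j \<in> J"
    have "\<bar>k j\<bar> \<noteq> \<bar>k i\<bar>" if "j \<noteq> i" using inj j i that by (auto dest: inj_onD)
    then show "coeff (monom (C j) (nat (K + k j)) + monom (cnj (C j)) (nat (K - k j)))
        (nat (K + k i)) = (if j = i then C i + (if k i = 0 then cnj (C i) else 0) else 0)"
      using K[OF j] K[OF i] by (auto simp: nat_eq_iff)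
  qed
  then have coeff0: "C i + (if k i = 0 then cnj (C i) else 0) = 0"
    using \<open>P = 0\<close> fin i by simp
  show "a i = 0 \<and> b i = 0" if "k i \<noteq> 0"
  proof -
    have "Complex (a i) (- b i) = 0" using coeff0 that by (simp add: C_def)
    then show ?thesis by (simp add: complex_eq_iff)
  qed
  show "a i * cos (\<phi> i) + b i * sin (\<phi> i) = 0" if "k i = 0"
    using arg_cong[OF coeff0, of Re] that by (simp add: C_def)
qed

section \<open>Combinations modulo equivalence\<close>

text \<open>
  Membership of \<open>z\<close> in the prescribed range is automatic inside \<^term>\<open>combs n\<close>, so the equivalences of all
  levels are restrictions of one relation on all integer triples.
\<close>

definition sim :: "comb \<Rightarrow> comb \<Rightarrow> bool" where
  "sim e e' \<longleftrightarrow> (case (e, e') of ((r1, g1, b1), (r2, g2, b2)) \<Rightarrow>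
     r2 + r1 = g2 + g1 \<and> g2 + g1 = b2 + b1 \<or> r2 - r1 = g2 - g1 \<and> g2 - g1 = b2 - b1)"

lemma comb_equiv_iff_sim: "(e, e') \<in> comb_equiv n \<longleftrightarrow> e \<in> combs n \<and> e' \<in> combs n \<and> sim e e'"
  by (cases e; cases e') (simp add: sim_def comb_equiv_iff)

text \<open>
  In the plane coordinates \<open>p = r - b\<close>, \<open>q = g - b\<close> this is the hexagonal norm
  \<open>max \<bar>p\<bar> \<bar>q\<bar> \<bar>p - q\<bar>\<close>.
\<close>

fun spread :: "comb \<Rightarrow> int" where
  "spread (r, g, b) = max r (max g b) - min r (min g b)"

lemma spread_sim: "sim e e' \<Longrightarrow> spread e = spread e'"
  by (cases e; cases e') (auto simp: sim_def)

lemma spread_le: "e \<in> combs n \<Longrightarrow> spread e \<le> int n"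
  by (cases e) (auto simp: combs_def)

text \<open>Subtracting the least coefficient from all three moves a triple as low as it can go.\<close>

lemma ex_sim_in_combs:
  assumes "spread e \<le> int n"
  shows "\<exists>e'\<in>combs n. sim e e'"
proof -
  obtain r g b where e: "e = (r, g, b)" by (cases e)
  define m where "m = min r (min g b)"
  show ?thesis
    using assms unfolding e
    by (intro bexI[of _ "(r - m, g - m, b - m)"]) (auto simp: sim_def combs_def m_def)
qed

lemma new_class_iff_spread:
  assumes "n \<ge> 1" "e \<in> combs n"
  shows "comb_class n e \<in> new_classes n \<longleftrightarrow> spread e = int n"
proof -
  have "comb_class n e \<inter> combs (n - 1) = {} \<longleftrightarrow> \<not> (\<exists>e'\<in>combs (n - 1). sim e e')"
    using assms combs_mono[of "n - 1" n]
    unfolding disjoint_iff Image_singleton_iff comb_equiv_iff_sim by auto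
  also have "\<dots> \<longleftrightarrow> \<not> spread e \<le> int (n - 1)"
    using ex_sim_in_combs[of e "n - 1"] spread_le spread_sim by metis
  also have "\<dots> \<longleftrightarrow> spread e = int n"
    using spread_le[OF assms(2)] assms(1) by auto
  finally show ?thesis
    using assms by (simp add: new_classes_eq quotientI)
qed

lemma new_classes_image:
  assumes "n \<ge> 1"
  shows "new_classes n = comb_class n ` {e \<in> combs n. spread e = int n}"
proof -
  have "C \<in> comb_class n ` combs n" if "C \<in> new_classes n" for C
    using that assms by (auto simp: new_classes_eq quotient_def)
  then show ?thesis
    using new_class_iff_spread[OF assms] by blast
qed

lemma comb_class_eqI: "e \<in> combs n \<Longrightarrow> e' \<in> combs n \<Longrightarrow> sim e e' \<Longrightarrow> comb_class n e = comb_class n e'"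
  using equiv_class_eq[OF equiv_comb_equiv] by (simp add: comb_equiv_iff_sim)

lemma comb_class_eq_iff:
  assumes "e \<in> combs n" "e' \<in> combs n"
  shows "comb_class n e = comb_class n e' \<longleftrightarrow> sim e e'"
  using eq_equiv_class_iff[OF equiv_comb_equiv assms] assms by (simp add: comb_equiv_iff_sim)

text \<open>
  The triples of spread \<open>n\<close> in \<^term>\<open>combs n\<close> have some coefficient \<open>0\<close> and some coefficient \<open>n\<close>, which
  leaves six segments. The reflection \<open>e \<mapsto> (n, n, n) - e\<close> preserves classes and exchanges the segments
  in pairs; the three segments below contain one of each pair. Each omits its end point with
  two coefficients \<open>n\<close>, whose reflection is the end point with two coefficients \<open>0\<close> of another one.
\<close>

definition hexagon_half :: "nat \<Rightarrow> comb set" where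
  "hexagon_half n = (\<lambda>g. (0, g, int n)) ` {0..int n - 1} \<union>
     (\<lambda>b. (int n, 0, b)) ` {0..int n - 1} \<union> (\<lambda>r. (r, int n, 0)) ` {0..int n - 1}"

lemma hexagon_half_subset: "hexagon_half n \<subseteq> {e \<in> combs n. spread e = int n}"
  by (auto simp: hexagon_half_def combs_def)

lemma ex_sim_hexagon_half:
  assumes "n \<ge> 1" "e \<in> combs n" "spread e = int n"
  shows "\<exists>e'\<in>hexagon_half n. sim e e'"
proof -
  obtain r g b where e: "e = (r, g, b)" by (cases e)
  let ?N = "int n"
  have "(r, g, b) \<in> hexagon_half n \<or> (?N - r, ?N - g, ?N - b) \<in> hexagon_half n"
    using assms unfolding e hexagon_half_def
    by (auto simp: combs_def image_iff max_def min_def split: if_splits)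
  moreover have "sim e (r, g, b)" "sim e (?N - r, ?N - g, ?N - b)"
    by (auto simp: e sim_def)
  ultimately show ?thesis by blast
qed

lemma new_classes_hexagon_half:
  assumes "n \<ge> 1"
  shows "new_classes n = comb_class n ` hexagon_half n"
proof
  show "new_classes n \<subseteq> comb_class n ` hexagon_half n"
  proof
    fix C assume "C \<in> new_classes n"
    then obtain e where e: "e \<in> combs n" "spread e = int n" "C = comb_class n e"
      using new_classes_image[OF assms] by auto
    obtain e' where e': "e' \<in> hexagon_half n" "sim e e'"
      using ex_sim_hexagon_half[OF assms e(1,2)] by blast
    then have "C = comb_class n e'"
      using e comb_class_eqI[of e n e'] hexagon_half_subset by blast
    then show "C \<in> comb_class n ` hexagon_half n" using e' by blast
  qed
  show "comb_class n ` hexagon_half n \<subseteq> new_classes n"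
    using hexagon_half_subset unfolding new_classes_image[OF assms] by blast
qed

lemma sim_hexagon_half_eq:
  "e \<in> hexagon_half n \<Longrightarrow> e' \<in> hexagon_half n \<Longrightarrow> sim e e' \<Longrightarrow> e = e'"
  by (auto simp: hexagon_half_def sim_def)

lemma card_hexagon_half: "card (hexagon_half n) = 3 * n"
proof -
  let ?I = "{0..int n - 1}"
  have "card (hexagon_half n) = card ((\<lambda>g. (0 :: int, g, int n)) ` ?I) +
     card ((\<lambda>b. (int n, 0 :: int, b)) ` ?I) + card ((\<lambda>r. (r, int n, 0 :: int)) ` ?I)"
    unfolding hexagon_half_def by (subst card_Un_disjoint; (subst card_Un_disjoint)?) auto
  then show ?thesis by (simp add: card_image inj_on_def)
qed

lemma card_new_classes:
  assumes "n \<ge> 1"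
  shows "card (new_classes n) = 3 * n"
proof -
  have "inj_on (comb_class n) (hexagon_half n)"
    using hexagon_half_subset[of n] comb_class_eq_iff sim_hexagon_half_eq
    by (intro inj_onI) blast
  then show ?thesis
    by (simp add: new_classes_hexagon_half[OF assms] card_image card_hexagon_half)
qed

section \<open>Systems of representatives\<close>

text \<open>The constant class is left out: it contributes one function to the basis, the others two each.\<close>

definition reps :: "(nat \<Rightarrow> comb set \<Rightarrow> comb) \<Rightarrow> nat \<Rightarrow> comb set" where
  "reps rep n = (\<Union>m\<in>{1..n}. rep m ` new_classes m)"

lemma reps_0: "reps rep 0 = {}"
  by (simp add: reps_def)

lemma reps_Suc: "reps rep (Suc n) = reps rep n \<union> rep (Suc n) ` new_classes (Suc n)"
  by (auto simp: reps_def atLeastAtMostSuc_conv)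

context
  fixes rep :: "nat \<Rightarrow> comb set \<Rightarrow> comb"
  assumes choice: "choice_of_reps rep"
begin

lemma rep_new_class:
  assumes "m \<ge> 1" "C \<in> new_classes m"
  shows "rep m C \<in> combs m" "spread (rep m C) = int m" "comb_class m (rep m C) = C"
proof -
  obtain e where e: "e \<in> combs m" "spread e = int m" "C = comb_class m e"
    using assms new_classes_image by auto
  have "rep m C \<in> C" using choice assms by (auto simp: choice_of_reps_def)
  then have rep: "sim e (rep m C)" "rep m C \<in> combs m"
    using e(3) by (simp_all add: comb_equiv_iff_sim)
  show "rep m C \<in> combs m" by (rule rep(2))
  show "spread (rep m C) = int m" using spread_sim[OF rep(1)] e(2) by simp
  show "comb_class m (rep m C) = C" using comb_class_eqI[OF e(1) rep(2,1)] e(3) by simp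
qed

lemma reps_combs: "reps rep n \<subseteq> combs n"
proof
  fix e assume "e \<in> reps rep n"
  then obtain m C where "1 \<le> m" "m \<le> n" "C \<in> new_classes m" "e = rep m C"
    by (auto simp: reps_def)
  then show "e \<in> combs n" using rep_new_class(1)[of m C] combs_mono[of m n] by blast
qed

lemma finite_reps: "finite (reps rep n)"
  by (rule finite_subset[OF reps_combs[of n]]) (simp add: combs_def)

lemma reps_not_sim_0:
  assumes "e \<in> reps rep n"
  shows "\<not> sim e (0, 0, 0)"
proof
  assume "sim e (0, 0, 0)"
  then have "spread e = 0" using spread_sim[of e "(0, 0, 0)"] by simp
  moreover obtain m C where "1 \<le> m" "C \<in> new_classes m" "e = rep m C"
    using assms by (auto simp: reps_def)
  ultimately show False using rep_new_class(2)[of m C] by simp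
qed

lemma inj_on_rep: "m \<ge> 1 \<Longrightarrow> inj_on (rep m) (new_classes m)"
  by (rule inj_on_inverseI[of _ "comb_class m"]) (rule rep_new_class(3))

text \<open>
  Representatives chosen at different levels are inequivalent because their spreads differ, and at
  the same level because they lie in different classes.
\<close>

lemma reps_sim_eq:
  assumes "e \<in> reps rep n" "e' \<in> reps rep n" "sim e e'"
  shows "e = e'"
proof -
  obtain m C m' C' where
    m: "m \<ge> 1" "C \<in> new_classes m" "e = rep m C" and
    m': "m' \<ge> 1" "C' \<in> new_classes m'" "e' = rep m' C'"
    using assms(1,2) by (auto simp: reps_def)
  have "m = m'"
    using rep_new_class(2)[OF m(1,2)] rep_new_class(2)[OF m'(1,2)] spread_sim[OF assms(3)] m m'
    by simp
  then have "C = C'"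
    using rep_new_class(1,3)[OF m(1,2)] rep_new_class(1,3)[OF m'(1,2)] m(3) m'(3)
      comb_class_eqI[of e m e'] assms(3) by simp
  then show ?thesis using m m' \<open>m = m'\<close> by simp
qed

text \<open>
  A class that meets \<^term>\<open>combs n\<close> is new at the level given by its spread, or constant if the
  spread is \<open>0\<close>.
\<close>

lemma ex_sim_reps:
  assumes "e \<in> combs n"
  shows "sim e (0, 0, 0) \<or> (\<exists>e'\<in>reps rep n. sim e e')"
proof (cases "spread e \<ge> 1")
  case False
  then show ?thesis by (cases e) (auto simp: sim_def)
next
  case True
  define m where "m = nat (spread e)"
  have m: "m \<ge> 1" "spread e = int m" "m \<le> n"
    using True spread_le[OF assms] by (auto simp: m_def)
  obtain e' where e': "e' \<in> combs m" "sim e e'"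
    using ex_sim_in_combs[of e m] m by auto
  define C where "C = comb_class m e'"
  have C: "C \<in> new_classes m"
    using new_class_iff_spread[OF m(1) e'(1)] spread_sim[OF e'(2)] m by (simp add: C_def)
  then have "sim e' (rep m C)"
    using rep_new_class[OF m(1) C] e' comb_class_eq_iff C_def by blast
  then have "sim e (rep m C)"
    using e'(2) by (cases e; cases e'; cases "rep m C"; simp add: sim_def) linarith
  then show ?thesis using C m by (auto simp: reps_def)
qed

end

section \<open>The cosine and sine functions of a class\<close>

text \<open>
  Indexing the functions by a triple and a flag turns statements about sets of functions into
  statements about families. That different indices give different functions is then a
  consequence of linear independence and needs no separate argument.
\<close>

definition trig_fn :: "real \<Rightarrow> comb \<times> bool \<Rightarrow> (real \<times> real \<times> real \<Rightarrow> real)" where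
  "trig_fn \<alpha> = (\<lambda>(e, s). if s then cos_fn \<alpha> e else sin_fn \<alpha> e)"

text \<open>The class of \<open>(0, 0, 0)\<close> contributes only its cosine: its sine is the zero function.\<close>

definition basis_index :: "(nat \<Rightarrow> comb set \<Rightarrow> comb) \<Rightarrow> nat \<Rightarrow> (comb \<times> bool) set" where
  "basis_index rep n = insert ((0, 0, 0), True) (reps rep n \<times> UNIV)"

lemma trig_fn_image: "trig_fn \<alpha> ` (A \<times> UNIV) = cos_fn \<alpha> ` A \<union> sin_fn \<alpha> ` A"
proof -
  have "A \<times> (UNIV :: bool set) = (\<lambda>e. (e, True)) ` A \<union> (\<lambda>e. (e, False)) ` A"
    by (auto simp: UNIV_bool)
  then show ?thesis by (simp add: image_Un image_image trig_fn_def)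
qed

lemma one_eq_cos_fn: "on_Omega \<alpha> (\<lambda>_. 1) = cos_fn \<alpha> (0, 0, 0)"
  by (auto simp: on_Omega_def cos_fn_def)

lemma trig_space_eq: "trig_space \<alpha> n = span (trig_fn \<alpha> ` (combs n \<times> UNIV))"
  unfolding trig_space_def trig_fn_image ..

lemma new_fns_eq: "new_fns \<alpha> rep n = trig_fn \<alpha> ` ((rep n ` new_classes n) \<times> UNIV)"
  unfolding trig_fn_image by (auto simp: new_fns_def)

lemma trig_basis_eq: "trig_basis \<alpha> rep n = trig_fn \<alpha> ` basis_index rep n"
proof (induction n)
  case 0
  then show ?case by (simp add: basis_index_def reps_0 one_eq_cos_fn trig_fn_def)
next
  case (Suc n)
  then show ?case
    by (simp add: basis_index_def reps_Suc new_fns_eq image_Un Sigma_Un_distrib1)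
qed

text \<open>
  On \<^term>\<open>Omega \<alpha>\<close> equivalent combinations have values related by \<open>x = \<phi> \<plusminus> y\<close> with the constant
  \<open>\<phi> = z * \<alpha>\<close>, and the addition theorems express \<open>cos (\<phi> \<plusminus> y)\<close> and \<open>sin (\<phi> \<plusminus> y)\<close> through \<open>cos y\<close> and
  \<open>sin y\<close>.
\<close>

lemma trig_fn_sim_in_span:
  assumes "sim e e'"
  shows "trig_fn \<alpha> (e, s) \<in> span {cos_fn \<alpha> e', sin_fn \<alpha> e'}"
proof -
  obtain r g b r' g' b' where e: "e = (r, g, b)" "e' = (r', g', b')"
    by (cases e; cases e')
  have cases: "r' + r = g' + g \<and> g' + g = b' + b \<or> r' - r = g' - g \<and> g' - g = b' - b"
    using assms unfolding e sim_def prod.case .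
  have "\<exists>\<phi> \<sigma>. \<sigma> \<in> {1, -1} \<and> (\<forall>p\<in>Omega \<alpha>. comb_val e p = \<phi> + \<sigma> * comb_val e' p)"
    using cases
  proof (elim disjE conjE)
    assume sum: "r' + r = g' + g" "g' + g = b' + b"
    define z where "z = b' + b"
    have z: "r = z - r'" "g = z - g'" "b = z - b'" using sum by (simp_all add: z_def)
    have "\<forall>p\<in>Omega \<alpha>. comb_val (r, g, b) p = z * \<alpha> + (-1) * comb_val (r', g', b') p"
      unfolding z by (auto simp: Omega_def algebra_simps)
    then show ?thesis unfolding e by (intro exI[of _ "z * \<alpha>"] exI[of _ "-1"]) simp
  next
    assume diff: "r' - r = g' - g" "g' - g = b' - b"
    define z where "z = b - b'"
    have z: "r = z + r'" "g = z + g'" "b = z + b'" using diff by (simp_all add: z_def)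
    have "\<forall>p\<in>Omega \<alpha>. comb_val (r, g, b) p = z * \<alpha> + 1 * comb_val (r', g', b') p"
      unfolding z by (auto simp: Omega_def algebra_simps)
    then show ?thesis unfolding e by (intro exI[of _ "z * \<alpha>"] exI[of _ 1]) simp
  qed
  then obtain \<phi> \<sigma> where \<sigma>: "\<sigma> = 1 \<or> \<sigma> = -1"
    and val: "\<And>p. p \<in> Omega \<alpha> \<Longrightarrow> comb_val e p = \<phi> + \<sigma> * comb_val e' p"
    by blast
  have "cos_fn \<alpha> e = cos \<phi> *\<^sub>R cos_fn \<alpha> e' + (- \<sigma> * sin \<phi>) *\<^sub>R sin_fn \<alpha> e'"
    "sin_fn \<alpha> e = sin \<phi> *\<^sub>R cos_fn \<alpha> e' + (\<sigma> * cos \<phi>) *\<^sub>R sin_fn \<alpha> e'"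
    using \<sigma> by (auto simp: fun_eq_iff scaleR_fun_def cos_fn_def sin_fn_def on_Omega_def val
        cos_add sin_add cos_diff sin_diff)
  moreover have "x *\<^sub>R cos_fn \<alpha> e' + y *\<^sub>R sin_fn \<alpha> e' \<in> span {cos_fn \<alpha> e', sin_fn \<alpha> e'}" for x y
    by (intro span_add span_scale span_base) auto
  ultimately show ?thesis
    by (cases s) (simp_all only: trig_fn_def prod.case if_True if_False)
qed

lemma span_trig_basis:
  assumes "choice_of_reps rep"
  shows "span (trig_basis \<alpha> rep n) = trig_space \<alpha> n"
  unfolding trig_basis_eq trig_space_eq span_eq
proof
  have "(0, 0, 0) \<in> combs n" by (simp add: combs_def)
  then have "basis_index rep n \<subseteq> combs n \<times> UNIV"
    using reps_combs[OF assms] by (auto simp: basis_index_def)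
  then show "trig_fn \<alpha> ` basis_index rep n \<subseteq> span (trig_fn \<alpha> ` (combs n \<times> UNIV))"
    by (auto intro: span_base)
next
  let ?B = "trig_fn \<alpha> ` basis_index rep n"
  have "trig_fn \<alpha> (e, s) \<in> span ?B" if "e \<in> combs n" for e s
    using ex_sim_reps[OF assms that]
  proof (elim disjE bexE)
    assume "sim e (0, 0, 0)"
    moreover have "cos_fn \<alpha> (0, 0, 0) \<in> ?B"
      by (force simp: basis_index_def trig_fn_def)
    moreover have "sin_fn \<alpha> (0, 0, 0) = 0"
      by (auto simp: sin_fn_def on_Omega_def)
    ultimately show ?thesis
      using trig_fn_sim_in_span[of e "(0, 0, 0)" \<alpha> s] span_mono[of "{cos_fn \<alpha> (0, 0, 0)}" ?B]
      by (auto simp: insert_commute span_insert_0)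
  next
    fix e' assume e': "e' \<in> reps rep n" "sim e e'"
    have "{cos_fn \<alpha> e', sin_fn \<alpha> e'} = trig_fn \<alpha> ` ({e'} \<times> UNIV)"
      by (auto simp: trig_fn_def UNIV_bool)
    also have "\<dots> \<subseteq> ?B" using e' by (auto simp: basis_index_def)
    finally show ?thesis using trig_fn_sim_in_span[OF e'(2)] span_mono by blast
  qed
  then show "trig_fn \<alpha> ` (combs n \<times> UNIV) \<subseteq> span ?B" by auto
qed

section \<open>Linear independence\<close>

lemma independent_family:
  fixes F :: "'i \<Rightarrow> 'a::real_vector"
  assumes fin: "finite I"
    and zero: "\<And>c i. (\<Sum>i\<in>I. c i *\<^sub>R F i) = 0 \<Longrightarrow> i \<in> I \<Longrightarrow> c i = 0"
  shows "inj_on F I" "independent (F ` I)"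
proof -
  show inj: "inj_on F I"
  proof (rule inj_onI, rule ccontr)
    fix i j assume ij: "i \<in> I" "j \<in> I" "F i = F j" "i \<noteq> j"
    define c where "c l = (if l = i then 1 else if l = j then -1 else 0 :: real)" for l
    have "(\<Sum>l\<in>I. c l *\<^sub>R F l) = (\<Sum>l\<in>{i, j}. c l *\<^sub>R F l)"
      using fin ij by (intro sum.mono_neutral_right) (auto simp: c_def)
    also have "\<dots> = 0" using ij by (simp add: c_def)
    finally show False using zero[of c i] ij by (simp add: c_def)
  qed
  show "independent (F ` I)"
  proof (rule independent_if_scalars_zero)
    fix f x assume "(\<Sum>x\<in>F ` I. f x *\<^sub>R x) = 0" "x \<in> F ` I"
    then show "f x = 0" using zero[of "f \<circ> F"] inj by (auto simp: sum.reindex)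
  qed (use fin in simp)
qed

lemma sum_fun_apply: "(\<Sum>i\<in>I. f i) x = (\<Sum>i\<in>I. f i x)"
  by (induction I rule: infinite_finite_induct) auto

text \<open>
  The frequency in \<open>t\<close> of \<open>r u + g v + b w\<close> along \<open>(u, v, w) = (t, N t, \<alpha> - (N + 1) t)\<close>.
\<close>

definition line_freq :: "int \<Rightarrow> comb \<Rightarrow> int" where
  "line_freq N = (\<lambda>(r, g, b). (r - b) + (g - b) * N)"

text \<open>
  The plane frequencies have entries between \<open>-n\<close> and \<open>n\<close>, so sums and differences of two of them
  are bounded by \<open>2 n\<close>, and \<open>(p, q)\<close> can be read off from \<open>p + q N\<close> as a number in base
  \<open>N = 2 n + 1\<close>.
\<close>

lemma sim_if_abs_line_freq_eq:
  assumes "e \<in> combs n" "e' \<in> combs n"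
    and "\<bar>line_freq (2 * int n + 1) e\<bar> = \<bar>line_freq (2 * int n + 1) e'\<bar>"
  shows "sim e e'"
proof -
  have *: "p = 0 \<and> q = 0" if "p + q * (2 * int n + 1) = 0" "\<bar>p\<bar> \<le> 2 * int n" for p q
  proof -
    have "(2 * int n + 1) dvd p" using that(1) by (metis dvd_0_right dvd_add_left_iff dvd_triv_right)
    then have "p = 0" using that(2) dvd_imp_le_int[of p "2 * int n + 1"] by fastforce
    then show ?thesis using that(1) by auto
  qed
  obtain r g b r' g' b' where e: "e = (r, g, b)" "e' = (r', g', b')"
    by (cases e; cases e')
  show ?thesis
    using assms(3) unfolding abs_eq_iff
  proof
    assume "line_freq (2 * int n + 1) e = line_freq (2 * int n + 1) e'"
    then have eq: "((r - b) - (r' - b')) + ((g - b) - (g' - b')) * (2 * int n + 1) = 0"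
      by (simp add: e line_freq_def algebra_simps)
    have bound: "\<bar>(r - b) - (r' - b')\<bar> \<le> 2 * int n"
      using assms(1,2) by (simp add: e combs_def) linarith
    have "r' - r = g' - g \<and> g' - g = b' - b"
      using *[OF eq bound] by presburger
    then show ?thesis unfolding e sim_def prod.case by blast
  next
    assume "line_freq (2 * int n + 1) e = - line_freq (2 * int n + 1) e'"
    then have eq: "((r - b) + (r' - b')) + ((g - b) + (g' - b')) * (2 * int n + 1) = 0"
      by (simp add: e line_freq_def algebra_simps)
    have bound: "\<bar>(r - b) + (r' - b')\<bar> \<le> 2 * int n"
      using assms(1,2) by (simp add: e combs_def) linarith
    have "r' + r = g' + g \<and> g' + g = b' + b"
      using *[OF eq bound] by presburger
    then show ?thesis unfolding e sim_def prod.case by blast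
  qed
qed

text \<open>
  Restriction of a vanishing combination to the line gives a trigonometric polynomial that
  vanishes on an interval. The nonconstant classes have nonzero line frequency, so both of
  their coefficients vanish, and for the constant class the one coefficient is its value.
\<close>

lemma trig_fn_coeffs_zero:
  assumes "\<alpha> > 0" and rep: "choice_of_reps rep"
    and zero: "(\<Sum>i\<in>basis_index rep n. c i *\<^sub>R trig_fn \<alpha> i) = 0"
    and i: "i \<in> basis_index rep n"
  shows "c i = 0"
proof -
  let ?R = "reps rep n" and ?o = "(0, 0, 0) :: comb" and ?N = "2 * int n + 1"
  let ?J = "insert ?o ?R"
  have o_sim: "e = ?o" if "e \<in> ?J" "sim e ?o" for e
    using reps_not_sim_0[OF rep] that by blast
  have "?o \<notin> ?R" using reps_not_sim_0[OF rep, of ?o n] by (auto simp: sim_def)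
  have J: "?J \<subseteq> combs n" using reps_combs[OF rep] by (auto simp: combs_def)
  define a where "a e = c (e, True)" for e
  \<comment> \<open>The constant class has no sine in the family; its coefficient is set to \<open>0\<close>.\<close>
  define b where "b e = (if e = ?o then 0 else c (e, False))" for e
  define \<phi> where "\<phi> = (\<lambda>(r :: int, g :: int, b :: int). b * \<alpha>)"
  \<comment> \<open>For \<open>0 < t < \<epsilon>\<close> the segment stays inside \<open>Omega \<alpha>\<close>.\<close>
  define \<epsilon> where "\<epsilon> = \<alpha> / (?N + 1)"
  have inj: "inj_on (\<lambda>e. \<bar>line_freq ?N e\<bar>) ?J"
  proof (rule inj_onI)
    fix e e' assume ee': "e \<in> ?J" "e' \<in> ?J" "\<bar>line_freq ?N e\<bar> = \<bar>line_freq ?N e'\<bar>"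
    have "sim e e'" "sim e' e" using sim_if_abs_line_freq_eq ee' J by (metis subsetD)+
    then show "e = e'" using ee' o_sim reps_sim_eq[OF rep] by blast
  qed
  have sum_zero: "(\<Sum>e\<in>?J. a e * cos (line_freq ?N e * t + \<phi> e) +
      b e * sin (line_freq ?N e * t + \<phi> e)) = 0" if t: "0 < t" "t < \<epsilon>" for t :: real
  proof -
    define p where "p = (t, ?N * t, \<alpha> - (?N + 1) * t)"
    have "(?N + 1) * t < \<alpha>" using t by (simp add: \<epsilon>_def field_simps)
    moreover have nonneg: "0 \<le> t * (real n * 2)" using t by simp
    ultimately have p: "p \<in> Omega \<alpha>"
      using t by (simp add: p_def Omega_def algebra_simps) (use nonneg in linarith)
    have val: "comb_val e p = line_freq ?N e * t + \<phi> e" for e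
      by (cases e) (simp add: p_def line_freq_def \<phi>_def algebra_simps)
    have "0 = (\<Sum>i\<in>basis_index rep n. c i * trig_fn \<alpha> i p)"
      using fun_cong[OF zero, of p] by (simp add: sum_fun_apply scaleR_fun_def)
    also have "\<dots> = a ?o + (\<Sum>i\<in>?R \<times> UNIV. c i * trig_fn \<alpha> i p)"
      using finite_reps[OF rep, of n] \<open>?o \<notin> ?R\<close> p
      by (simp add: basis_index_def trig_fn_def cos_fn_def on_Omega_def a_def p_def)
    also have "(\<Sum>i\<in>?R \<times> UNIV. c i * trig_fn \<alpha> i p) =
        (\<Sum>e\<in>?R. \<Sum>s\<in>UNIV. c (e, s) * trig_fn \<alpha> (e, s) p)"
      by (simp add: sum.cartesian_product split_def)
    also have "\<dots> = (\<Sum>e\<in>?R. a e * cos (line_freq ?N e * t + \<phi> e) +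
        b e * sin (line_freq ?N e * t + \<phi> e))"
      using \<open>?o \<notin> ?R\<close> p
      by (intro sum.cong refl) (auto simp: UNIV_bool trig_fn_def cos_fn_def sin_fn_def on_Omega_def
          a_def b_def val)
    finally show ?thesis
      using finite_reps[OF rep, of n] \<open>?o \<notin> ?R\<close> by (simp add: b_def line_freq_def \<phi>_def)
  qed
  have "\<epsilon> > 0" using assms(1) by (simp add: \<epsilon>_def)
  note coeffs = trig_poly_coeffs_zero[of ?J \<epsilon> "line_freq ?N" a \<phi> b, OF _ this inj sum_zero]
  consider "i = (?o, True)" | e s where "i = (e, s)" "e \<in> ?R"
    using i by (auto simp: basis_index_def)
  then show ?thesis
  proof cases
    case 1
    then show ?thesis
      using coeffs(2)[of ?o] finite_reps[OF rep] by (simp add: a_def b_def line_freq_def \<phi>_def)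
  next
    case (2 e s)
    have "line_freq ?N e \<noteq> 0"
    proof
      assume "line_freq ?N e = 0"
      then have "\<bar>line_freq ?N e\<bar> = \<bar>line_freq ?N ?o\<bar>" by (simp add: line_freq_def)
      then show False using inj_onD[OF inj] 2 \<open>?o \<notin> ?R\<close> by blast
    qed
    then have "a e = 0 \<and> b e = 0" using coeffs(1)[of e] finite_reps[OF rep] 2 by blast
    moreover have "e \<noteq> ?o" using 2 \<open>?o \<notin> ?R\<close> by blast
    ultimately show ?thesis using 2 by (cases s) (simp_all add: a_def b_def)
  qed
qed

lemma trig_basis_independent:
  assumes "\<alpha> > 0" "choice_of_reps rep"
  shows "inj_on (trig_fn \<alpha>) (basis_index rep n)" "independent (trig_basis \<alpha> rep n)"
proof -
  have "finite (basis_index rep n)"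
    by (simp add: basis_index_def finite_reps[OF assms(2)])
  then show "inj_on (trig_fn \<alpha>) (basis_index rep n)" "independent (trig_basis \<alpha> rep n)"
    unfolding trig_basis_eq by (rule independent_family; use trig_fn_coeffs_zero[OF assms] in blast)+
qed

lemma new_reps_disjoint:
  assumes "choice_of_reps rep"
  shows "insert (0, 0, 0) (reps rep n) \<inter> rep (Suc n) ` new_classes (Suc n) = {}"
proof -
  have "spread e = int (Suc n)" if "e \<in> rep (Suc n) ` new_classes (Suc n)" for e
    using rep_new_class(2)[OF assms, of "Suc n"] that by auto
  moreover have "spread e \<le> int n" if "e \<in> insert (0, 0, 0) (reps rep n)" for e
  proof (cases "e = (0, 0, 0)")
    case False
    then have "e \<in> combs n" using that reps_combs[OF assms] by blast
    then show ?thesis by (rule spread_le)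
  qed simp
  ultimately show ?thesis by fastforce
qed

theorem proposition4p1:
  fixes \<alpha> :: real and rep :: "nat \<Rightarrow> comb set \<Rightarrow> comb"
  assumes "\<alpha> \<in> {0<..<pi}"
    and "choice_of_reps rep"
  shows "(\<forall>n \<ge> 1. new_classes n =
            (\<lambda>g. comb_class n (0, g, int n)) ` {0..int n - 1} \<union>
            (\<lambda>b. comb_class n (int n, 0, b)) ` {0..int n - 1} \<union>
            (\<lambda>r. comb_class n (r, int n, 0)) ` {0..int n - 1}) \<and>
         (\<forall>n. independent (trig_basis \<alpha> rep n) \<and>
              span (trig_basis \<alpha> rep n) = trig_space \<alpha> n) \<and>
         (\<forall>n \<ge> 1. trig_basis \<alpha> rep n = trig_basis \<alpha> rep (n - 1) \<union> new_fns \<alpha> rep n \<and>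
              trig_basis \<alpha> rep (n - 1) \<inter> new_fns \<alpha> rep n = {} \<and>
              card (new_fns \<alpha> rep n) = 6 * n \<and>
              independent (new_fns \<alpha> rep n))"
proof (intro conjI allI impI)
  have pos: "\<alpha> > 0" using assms(1) by simp
  note indep = trig_basis_independent[OF pos assms(2)]
  fix n :: nat
  show "independent (trig_basis \<alpha> rep n)" by (rule indep(2))
  show "span (trig_basis \<alpha> rep n) = trig_space \<alpha> n" by (rule span_trig_basis[OF assms(2)])
  assume n: "n \<ge> 1"
  show "new_classes n =
            (\<lambda>g. comb_class n (0, g, int n)) ` {0..int n - 1} \<union>
            (\<lambda>b. comb_class n (int n, 0, b)) ` {0..int n - 1} \<union>
            (\<lambda>r. comb_class n (r, int n, 0)) ` {0..int n - 1}"
    by (simp add: new_classes_hexagon_half[OF n] hexagon_half_def image_Un image_image)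
  obtain k where k: "n = Suc k" using n by (cases n) auto
  let ?new = "rep n ` new_classes n"
  show step: "trig_basis \<alpha> rep n = trig_basis \<alpha> rep (n - 1) \<union> new_fns \<alpha> rep n"
    by (simp add: k)
  show "independent (new_fns \<alpha> rep n)"
    using indep(2)[of n] step by (metis independent_mono sup_ge2)
  have index: "basis_index rep n = basis_index rep k \<union> ?new \<times> UNIV"
    by (auto simp: k basis_index_def reps_Suc)
  have "basis_index rep k \<inter> ?new \<times> UNIV = {}"
    using new_reps_disjoint[OF assms(2), of k] by (auto simp: k basis_index_def)
  moreover have "trig_fn \<alpha> ` (basis_index rep k \<inter> ?new \<times> UNIV) =
      trig_fn \<alpha> ` basis_index rep k \<inter> trig_fn \<alpha> ` (?new \<times> UNIV)"
    by (rule inj_on_image_Int[OF indep(1)[of n]]) (simp_all add: index)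
  ultimately show "trig_basis \<alpha> rep (n - 1) \<inter> new_fns \<alpha> rep n = {}"
    by (simp add: trig_basis_eq new_fns_eq k)
  have "card (new_fns \<alpha> rep n) = card (?new \<times> (UNIV :: bool set))"
    unfolding new_fns_eq using indep(1)[of n] by (intro card_image) (simp add: index inj_on_Un)
  then show "card (new_fns \<alpha> rep n) = 6 * n"
    by (simp add: card_cartesian_product card_image inj_on_rep[OF assms(2) n] card_new_classes[OF n])
qed

end
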